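(* Let $\{v_j\}_{j=1}^k$ be a frame in $\mathbb{R}^n$ with frame bounds $A,B>0$. If $\epsilon\le \frac{\sqrt{A}}{\sqrt{k}}$, then for all vectors $\delta_1,\dots,\delta_k\in\mathbb{R}^n$ with $\|\delta_j\|<\epsilon$ for every $j$, the family $\{v_j+\delta_j\}_{j=1}^k$ is a frame in $\mathbb{R}^n$.
   Context: A finite family $\{x_j\}_{j=1}^k$ of vectors in $\mathbb{R}^n$ is a frame with frame bounds $0<A\le B<\infty$ ($A$ lower, $B$ upper) if $A\|x\|^2\le \sum_{j=1}^k|\langle x,x_j\rangle|^2\le B\|x\|^2$ for all $x\in\mathbb{R}^n$; it is a frame if such $A,B$ exist. *)

theory Defs
  imports "HOL-Analysis.Analysis"
begin

text \<open>A finite family of \<open>k\<close> vectors is a function on \<open>nat\<close> of which only the values at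
  the indices \<open>1, \<dots>, k\<close> matter.\<close>

definition frame_with_bounds :: "nat \<Rightarrow> (nat \<Rightarrow> real ^ 'n) \<Rightarrow> real \<Rightarrow> real \<Rightarrow> bool" where
  "frame_with_bounds k v A B \<longleftrightarrow>
     0 < A \<and> A \<le> B \<and>
     (\<forall>x. A * (norm x)\<^sup>2 \<le> (\<Sum>j=1..k. \<bar>x \<bullet> v j\<bar>\<^sup>2) \<and>
          (\<Sum>j=1..k. \<bar>x \<bullet> v j\<bar>\<^sup>2) \<le> B * (norm x)\<^sup>2)"

definition is_frame :: "nat \<Rightarrow> (nat \<Rightarrow> real ^ 'n) \<Rightarrow> bool" where
  "is_frame k v \<longleftrightarrow> (\<exists>A B. frame_with_bounds k v A B)"

end

theory Submission
  imports Defs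
begin

text \<open>The analysis operator \<open>x \<mapsto> (x \<bullet> w\<^sub>j)\<^sub>j\<close> of a finite family is bounded by the \<open>\<ell>\<^sup>2\<close>-norm of
  \<open>(\<parallel>w\<^sub>j\<parallel>)\<^sub>j\<close>, so only the lower frame bound matters. The hypothesis on \<open>\<epsilon>\<close> makes the norm of the
  analysis operator of \<open>\<delta>\<close> strictly smaller than \<open>sqrt A\<close>, and the triangle inequality in \<open>\<ell>\<^sup>2\<close>
  then leaves a positive lower bound for \<open>v + \<delta>\<close>.\<close>

lemma L2_set_inner_le:
  fixes w :: "'i \<Rightarrow> 'a::real_inner"
  shows "L2_set (\<lambda>j. x \<bullet> w j) I \<le> L2_set (\<lambda>j. norm (w j)) I * norm x"
proof -
  have "L2_set (\<lambda>j. x \<bullet> w j) I = L2_set (\<lambda>j. \<bar>x \<bullet> w j\<bar>) I"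
    by (simp add: L2_set_def)
  also have "\<dots> \<le> L2_set (\<lambda>j. norm (w j) * norm x) I"
    by (rule L2_set_mono) (simp_all add: Cauchy_Schwarz_ineq2 mult.commute)
  also have "\<dots> = L2_set (\<lambda>j. norm (w j)) I * norm x"
    by (simp add: L2_set_left_distrib)
  finally show ?thesis .
qed

lemma sum_inner_eq_L2_set:
  "(\<Sum>j\<in>I. \<bar>x \<bullet> w j\<bar>\<^sup>2) = (L2_set (\<lambda>j. x \<bullet> w j) I)\<^sup>2"
  by (simp add: L2_set_def sum_nonneg)

text \<open>The upper bound comes for free from \<open>L2_set_inner_le\<close>, so a positive lower
  bound on the analysis operator suffices. Squaring turns both estimates into frame bounds.\<close>

lemma is_frame_if_lower_bound:
  fixes w :: "nat \<Rightarrow> real ^ 'n"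
  assumes "0 < a" and lower: "\<And>x. a * norm x \<le> L2_set (\<lambda>j. x \<bullet> w j) {1..k}"
  shows "is_frame k w"
proof -
  let ?b = "L2_set (\<lambda>j. norm (w j)) {1..k}"
  have "a\<^sup>2 * (norm x)\<^sup>2 \<le> (\<Sum>j=1..k. \<bar>x \<bullet> w j\<bar>\<^sup>2)" for x
    unfolding sum_inner_eq_L2_set power_mult_distrib [symmetric]
    using assms by (intro power_mono) auto
  \<comment> \<open>The summand \<open>a\<^sup>2\<close> makes the lower bound at most the upper one
    by construction, with no comparison of \<open>a\<close> and \<open>?b\<close>.\<close>
  moreover have "(\<Sum>j=1..k. \<bar>x \<bullet> w j\<bar>\<^sup>2) \<le> (a\<^sup>2 + ?b\<^sup>2) * (norm x)\<^sup>2" for x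
  proof -
    have "(\<Sum>j=1..k. \<bar>x \<bullet> w j\<bar>\<^sup>2) \<le> (?b * norm x)\<^sup>2"
      unfolding sum_inner_eq_L2_set by (intro power_mono L2_set_inner_le L2_set_nonneg)
    also have "\<dots> \<le> (a\<^sup>2 + ?b\<^sup>2) * (norm x)\<^sup>2"
      by (simp add: power_mult_distrib distrib_right)
    finally show ?thesis .
  qed
  ultimately have "frame_with_bounds k w (a\<^sup>2) (a\<^sup>2 + ?b\<^sup>2)"
    using \<open>0 < a\<close> by (simp add: frame_with_bounds_def)
  then show ?thesis
    unfolding is_frame_def by blast
qed

lemma frame_with_bounds_lower:
  assumes "frame_with_bounds k v A B"
  shows "sqrt A * norm x \<le> L2_set (\<lambda>j. x \<bullet> v j) {1..k}"
proof -
  have "sqrt (A * (norm x)\<^sup>2) \<le> sqrt (\<Sum>j=1..k. \<bar>x \<bullet> v j\<bar>\<^sup>2)"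
    using assms by (simp add: frame_with_bounds_def)
  then show ?thesis
    by (simp add: L2_set_def real_sqrt_mult)
qed

text \<open>Index types are nonempty, so \<open>real ^ 'n\<close> contains a unit vector, on which
  an empty family violates the lower bound. Positivity of \<open>k\<close> is what permits clearing
  the denominator \<open>sqrt k\<close> and keeps the bound on the perturbation strict.\<close>

lemma frame_with_bounds_pos_card:
  fixes v :: "nat \<Rightarrow> real ^ 'n"
  assumes "frame_with_bounds k v A B"
  shows "0 < k"
proof (rule ccontr)
  assume "\<not> 0 < k"
  then have "sqrt A * norm (axis undefined 1 :: real ^ 'n) \<le> 0"
    using frame_with_bounds_lower [OF assms, of "axis undefined 1"] by simp
  then show False
    using assms by (simp add: frame_with_bounds_def)
qed

text \<open>Strictness survives summation because \<open>I\<close> is finite and nonempty.\<close>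

lemma L2_set_less_of_bounded:
  assumes "finite I" "I \<noteq> {}" and "\<And>i. i \<in> I \<Longrightarrow> 0 \<le> f i" "\<And>i. i \<in> I \<Longrightarrow> f i < e"
  shows "L2_set f I < sqrt (card I) * e"
proof -
  have "0 \<le> e"
    using assms by force
  have "(\<Sum>i\<in>I. (f i)\<^sup>2) < (\<Sum>i\<in>I. e\<^sup>2)"
    using assms by (intro sum_strict_mono power_strict_mono) auto
  then have "L2_set f I < sqrt (card I * e\<^sup>2)"
    by (simp add: L2_set_def)
  then show ?thesis
    using \<open>0 \<le> e\<close> by (simp add: real_sqrt_mult)
qed

theorem proposition4p1:
  fixes k :: nat and v :: "nat \<Rightarrow> real ^ 'n" and A B \<epsilon> :: real
  assumes "frame_with_bounds k v A B"
    and "\<epsilon> \<le> sqrt A / sqrt (real k)"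
  shows "\<forall>\<delta> :: nat \<Rightarrow> real ^ 'n.
           (\<forall>j\<in>{1..k}. norm (\<delta> j) < \<epsilon>) \<longrightarrow> is_frame k (\<lambda>j. v j + \<delta> j)"
proof (intro allI impI)
  fix \<delta> :: "nat \<Rightarrow> real ^ 'n"
  assume small: "\<forall>j\<in>{1..k}. norm (\<delta> j) < \<epsilon>"
  let ?s = "L2_set (\<lambda>j. norm (\<delta> j)) {1..k}"
  have "0 < k"
    using assms(1) by (rule frame_with_bounds_pos_card)
  then have "?s < sqrt k * \<epsilon>"
    using L2_set_less_of_bounded [of "{1..k}" "\<lambda>j. norm (\<delta> j)" \<epsilon>] small by simp
  also have "\<dots> \<le> sqrt A"
    using assms(2) \<open>0 < k\<close> by (simp add: field_simps)
  finally have "0 < sqrt A - ?s"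
    by simp
  moreover have "(sqrt A - ?s) * norm x \<le> L2_set (\<lambda>j. x \<bullet> (v j + \<delta> j)) {1..k}" for x
  proof -
    \<comment> \<open>Splitting \<open>v j\<close> as
      \<open>(v j + \<delta> j) + (- \<delta> j)\<close> yields the reverse triangle inequality from
      the ordinary one.\<close>
    have "sqrt A * norm x \<le> L2_set (\<lambda>j. x \<bullet> (v j + \<delta> j) + x \<bullet> - \<delta> j) {1..k}"
      using frame_with_bounds_lower [OF assms(1)] by (simp add: inner_add_right)
    also have "\<dots> \<le> L2_set (\<lambda>j. x \<bullet> (v j + \<delta> j)) {1..k} + L2_set (\<lambda>j. x \<bullet> - \<delta> j) {1..k}"
      by (rule L2_set_triangle_ineq)
    also have "L2_set (\<lambda>j. x \<bullet> - \<delta> j) {1..k} \<le> ?s * norm x"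
      using L2_set_inner_le [of x "\<lambda>j. - \<delta> j"] by simp
    finally show ?thesis
      by (simp add: left_diff_distrib)
  qed
  ultimately show "is_frame k (\<lambda>j. v j + \<delta> j)"
    by (rule is_frame_if_lower_bound)
qed

end
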